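(* Let $R$ be a commutative local dual ring. Then the radical-annihilator monoid of $R$ is one of the following two types: (a) satisfying the relations $r=a^2=1$ (this is the case when $R$ is a field); (b) satisfying the relations $a^2=1$ and $rar=rara$. In type (a) the $K$-number of $R$ is $2$, and in type (b) the $K$-number of $R$ is at most $8$. Furthermore, for every (possibly nonlocal) commutative dual ring, the relation $rar=rarara$ holds in its radical-annihilator monoid, and its $K$-number is at most $10$.
   Context: Rings have an identity. For a commutative ring $R$ and an ideal $I$ of $R$: $r(I)$ is the intersection of the prime ideals containing $I$ (with $r(R)=R$), and $a(I)=\{x\in R\mid xI=\{0\}\}$ is the annihilator of $I$. Both $r$ and $a$ are regarded as maps from the set of ideals of $R$ to itself; products denote composition, e.g. $rar(I)=r(a(r(I)))$, and $1$ is the identity map. The radical-annihilator monoid of $R$ is the monoid of maps on the set of ideals of $R$ generated by $r$ and $a$ under composition; its cardinality is the $K$-number of $R$. A commutative ring $R$ is dual if $a(a(I))=I$ for every ideal $I$, i.e. $a^2=1$. *)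

theory Defs
  imports "HOL-Algebra.Ideal" "HOL-Library.FuncSet" "HOL-Library.Extended_Nat" "HOL.Hull"
begin

definition ideals :: "('a, 'b) ring_scheme \<Rightarrow> 'a set set" where
  "ideals R = {I. ideal I R}"

(* Intersecting with the carrier only matters when no prime ideal contains I, i.e. for I = R,
   where it yields r(R) = R. *)
definition radical :: "('a, 'b) ring_scheme \<Rightarrow> 'a set \<Rightarrow> 'a set" where
  "radical R I = carrier R \<inter> \<Inter>{P. primeideal P R \<and> I \<subseteq> P}"

definition annihilator :: "('a, 'b) ring_scheme \<Rightarrow> 'a set \<Rightarrow> 'a set" where
  "annihilator R I = {x \<in> carrier R. (\<lambda>y. x \<otimes>\<^bsub>R\<^esub> y) ` I = {\<zero>\<^bsub>R\<^esub>}}"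

definition dual_ring :: "('a, 'b) ring_scheme \<Rightarrow> bool" where
  "dual_ring R \<longleftrightarrow> cring R \<and> (\<forall>I \<in> ideals R. annihilator R (annihilator R I) = I)"

(* A maximal ideal is proper by definition, so the zero ring is not local. *)
definition local_ring :: "('a, 'b) ring_scheme \<Rightarrow> bool" where
  "local_ring R \<longleftrightarrow> cring R \<and> (\<exists>!M. maximalideal M R)"

(* Maps are extensional (undefined outside the set of ideals), so that HOL equality of two of
   them is equality as maps on the set of ideals. *)
definition ideal_maps :: "('a, 'b) ring_scheme \<Rightarrow> ('a set \<Rightarrow> 'a set) monoid" where
  "ideal_maps R =
    \<lparr>carrier = ideals R \<rightarrow>\<^sub>E ideals R,
     mult = compose (ideals R),
     one = (\<lambda>I \<in> ideals R. I)\<rparr>"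

definition rad_map :: "('a, 'b) ring_scheme \<Rightarrow> 'a set \<Rightarrow> 'a set" where
  "rad_map R = restrict (radical R) (ideals R)"

definition ann_map :: "('a, 'b) ring_scheme \<Rightarrow> 'a set \<Rightarrow> 'a set" where
  "ann_map R = restrict (annihilator R) (ideals R)"

definition rad_ann_monoid :: "('a, 'b) ring_scheme \<Rightarrow> ('a set \<Rightarrow> 'a set) monoid" where
  "rad_ann_monoid R =
    (ideal_maps R)
      \<lparr>carrier := (\<lambda>N. submonoid N (ideal_maps R)) hull {rad_map R, ann_map R}\<rparr>"

(* An extended natural number, because card is 0 on infinite sets. *)
definition K_number :: "('a, 'b) ring_scheme \<Rightarrow> enat" where
  "K_number R =
    (if finite (carrier (rad_ann_monoid R)) then enat (card (carrier (rad_ann_monoid R))) else \<infinity>)"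

definition type_a :: "('a, 'b) ring_scheme \<Rightarrow> bool" where
  "type_a R \<longleftrightarrow>
    (let M = rad_ann_monoid R; r = rad_map R; a = ann_map R in
      r = \<one>\<^bsub>M\<^esub> \<and> a \<otimes>\<^bsub>M\<^esub> a = \<one>\<^bsub>M\<^esub>)"

definition type_b :: "('a, 'b) ring_scheme \<Rightarrow> bool" where
  "type_b R \<longleftrightarrow>
    (let M = rad_ann_monoid R; r = rad_map R; a = ann_map R in
      a \<otimes>\<^bsub>M\<^esub> a = \<one>\<^bsub>M\<^esub> \<and>
      r \<otimes>\<^bsub>M\<^esub> a \<otimes>\<^bsub>M\<^esub> r = r \<otimes>\<^bsub>M\<^esub> a \<otimes>\<^bsub>M\<^esub> r \<otimes>\<^bsub>M\<^esub> a)"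

lemma monoid_ideal_maps: "monoid (ideal_maps R)"
proof (rule monoidI, unfold ideal_maps_def, simp_all)
  fix f g h assume f: "f \<in> ideals R \<rightarrow>\<^sub>E ideals R"
    and g: "g \<in> ideals R \<rightarrow>\<^sub>E ideals R" and h: "h \<in> ideals R \<rightarrow>\<^sub>E ideals R"
  show "compose (ideals R) f g \<in> ideals R \<rightarrow>\<^sub>E ideals R"
    using f g by (auto simp: compose_def)
  show "compose (ideals R) (compose (ideals R) f g) h
      = compose (ideals R) f (compose (ideals R) g h)"
    using h by (auto simp: compose_def fun_eq_iff)
  show "compose (ideals R) (\<lambda>I\<in>ideals R. I) f = f"
    using f by (auto intro: Id_compose simp: PiE_def)
  show "compose (ideals R) f (\<lambda>I\<in>ideals R. I) = f"
    using f by (auto intro: compose_Id simp: PiE_def)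
qed

lemma rad_map_closed:
  assumes "cring R"
  shows "rad_map R \<in> carrier (ideal_maps R)"
proof -
  interpret cring R by fact
  have "ideal (radical R I) R" for I
  proof -
    have eq: "radical R I = \<Inter>(insert (carrier R) {P. primeideal P R \<and> I \<subseteq> P})"
      by (auto simp: radical_def)
    show ?thesis
      unfolding eq by (rule i_Intersect) (auto intro: oneideal primeideal.axioms(1))
  qed
  then show ?thesis
    by (auto simp: rad_map_def ideal_maps_def ideals_def)
qed

lemma ann_map_closed:
  fixes R (structure)
  assumes "cring R"
  shows "ann_map R \<in> carrier (ideal_maps R)"
proof -
  interpret cring R by fact
  have "ideal (annihilator R I) R" if "ideal I R" for I
  proof -
    interpret I: ideal I R by fact
    have zero: "\<zero> \<in> I"
      by (rule I.zero_closed)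
    have eq: "annihilator R I = {x \<in> carrier R. \<forall>y \<in> I. x \<otimes> y = \<zero>}"
      by (auto simp: annihilator_def image_constant[OF zero])
    have mult: "(z \<otimes> x) \<otimes> y = \<zero>" if "x \<in> carrier R" "z \<in> carrier R" "y \<in> I" "x \<otimes> y = \<zero>" for x y z
      using that I.Icarr by (simp add: m_assoc)
    show ?thesis
    proof (rule idealI)
      show "ring R"
        by (rule ring_axioms)
      show "subgroup (annihilator R I) (add_monoid R)"
        unfolding eq
        by (rule add.subgroupI)
           (use zero in \<open>auto simp: l_distr l_minus I.Icarr simp flip: a_inv_def\<close>)
      fix x z assume "x \<in> annihilator R I" "z \<in> carrier R"
      then show "z \<otimes> x \<in> annihilator R I" and "x \<otimes> z \<in> annihilator R I"
        unfolding eq using mult by (auto simp: m_comm[of x z])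
    qed
  qed
  then show ?thesis
    by (auto simp: ann_map_def ideal_maps_def ideals_def)
qed

end

theory Submission
  imports Defs "HOL-Algebra.Ring_Divisibility"
begin

text \<open>
  Let \<open>N\<close> be the nilradical. In a dual ring, \<open>ann y \<subseteq> ann x\<close> implies \<open>x \<in> (y)\<close>. If \<open>x \<in> a(N)\<close>, then
  \<open>x\<^sup>2\<close> and \<open>x\<^sup>3\<close> have the same annihilator, so \<open>x\<^sup>2 = y x\<^sup>3\<close> for some \<open>y\<close> and \<open>(x)\<close> contains an
  idempotent \<open>e\<close> with \<open>x\<^sup>2 e = x\<^sup>2\<close>. Hence the radical of an ideal \<open>K \<subseteq> a(N)\<close> is determined by the
  idempotents of \<open>K\<close>: it consists of all \<open>z\<close> with \<open>z (1 - e) \<in> N\<close> for some idempotent \<open>e \<in> K\<close>.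
  The idempotents of \<open>a(r(I))\<close> are those of \<open>a(N) \<inter> a(I)\<close>, which gives \<open>rar = rarara\<close>. If the ring
  is local and not a field, then \<open>a(N) \<subseteq> N\<close>, so \<open>rar\<close> is constant with value \<open>N\<close>.
\<close>

section \<open>Radicals and annihilators in commutative rings\<close>

text \<open>Zorn's lemma, with \<open>S\<close> left arbitrary because two sets are avoided later:
  the powers of an element, where the maximal ideal found is prime, and \<open>{\<one>}\<close>,
  where it is a maximal ideal of the ring.\<close>

lemma (in ring) ideal_maximal_disjoint:
  assumes I: "ideal I R" and disj: "I \<inter> S = {}"
  obtains M where "ideal M R" "I \<subseteq> M" "M \<inter> S = {}"
    "\<And>J. \<lbrakk>ideal J R; M \<subseteq> J; J \<inter> S = {}\<rbrakk> \<Longrightarrow> J = M"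
proof -
  let ?A = "{J. ideal J R \<and> I \<subseteq> J \<and> J \<inter> S = {}}"
  have "\<exists>M\<in>?A. \<forall>J\<in>?A. M \<subseteq> J \<longrightarrow> J = M"
  proof (rule subset_Zorn_nonempty)
    show "?A \<noteq> {}"
      using I disj by blast
    fix C assume C: "C \<noteq> {}" "subset.chain ?A C"
    then have "subset.chain {J. ideal J R} C"
      by (auto simp: pred_on.chain_def)
    from chain_Union_is_ideal[OF this] C(1) have "ideal (\<Union>C) R"
      by simp
    moreover have "C \<subseteq> ?A"
      using C(2) by (simp only: pred_on.chain_def)
    then have "I \<subseteq> \<Union>C" "\<Union>C \<inter> S = {}"
      using C(1) by blast+
    ultimately show "\<Union>C \<in> ?A"
      by simp
  qed
  then obtain M where MA: "M \<in> ?A" and max: "\<forall>J\<in>?A. M \<subseteq> J \<longrightarrow> J = M"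
    by (rule bexE)
  from MA have M: "ideal M R" "I \<subseteq> M" "M \<inter> S = {}"
    by auto
  show thesis
  proof (rule that[OF M])
    show "J = M" if "ideal J R" "M \<subseteq> J" "J \<inter> S = {}" for J
      using that M(2) by (intro max[rule_format]) auto
  qed
qed

context cring
begin

text \<open>The definition asks for an image equal to \<open>{\<zero>}\<close>, which an empty set
  would fail. An ideal contains zero, so the pointwise form is equivalent.\<close>

lemma annihilator_iff:
  assumes "ideal I R"
  shows "x \<in> annihilator R I \<longleftrightarrow> x \<in> carrier R \<and> (\<forall>y\<in>I. x \<otimes> y = \<zero>)"
proof -
  have "\<zero> \<in> I"
    using assms additive_subgroup.zero_closed ideal.axioms(1) by blast
  then show ?thesis
    by (auto simp: annihilator_def image_constant)
qed

lemma ideal_annihilator: "ideal I R \<Longrightarrow> ideal (annihilator R I) R"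
  using ann_map_closed[OF is_cring] by (auto simp: ann_map_def ideal_maps_def ideals_def)

lemma ideal_radical: "ideal I R \<Longrightarrow> ideal (radical R I) R"
  using rad_map_closed[OF is_cring] by (auto simp: rad_map_def ideal_maps_def ideals_def)

lemma annihilator_antimono:
  assumes "ideal I R" "ideal J R" "I \<subseteq> J"
  shows "annihilator R J \<subseteq> annihilator R I"
  using assms(3) unfolding subset_iff annihilator_iff[OF assms(1)] annihilator_iff[OF assms(2)]
  by blast

lemma radical_mono: "I \<subseteq> J \<Longrightarrow> radical R I \<subseteq> radical R J"
  by (auto simp: radical_def)

lemma nilradical_subset_radical: "ideal I R \<Longrightarrow> radical R {\<zero>} \<subseteq> radical R I"
  by (rule radical_mono) (simp add: additive_subgroup.zero_closed ideal.axioms(1))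

lemma subset_radical: "ideal I R \<Longrightarrow> I \<subseteq> radical R I"
  by (auto simp: radical_def ideal.Icarr)

lemma radical_radical: "ideal I R \<Longrightarrow> radical R (radical R I) = radical R I"
  by (auto simp: radical_def)

section \<open>Radicals in terms of powers of elements\<close>

text \<open>Krull's argument: if neither x nor y is in M, then M + (x) and M + (y) both contain
  powers of z. The product of these powers lies in M + (xy), so xy in M would put a power of z into
  M.\<close>

lemma primeideal_of_disjoint_powers:
  assumes M: "ideal M R" and z: "z \<in> carrier R" and disj: "M \<inter> range (\<lambda>n::nat. z [^] n) = {}"
    and max: "\<And>J. \<lbrakk>ideal J R; M \<subseteq> J; J \<inter> range (\<lambda>n::nat. z [^] n) = {}\<rbrakk> \<Longrightarrow> J = M"
  shows "primeideal M R"
proof (rule primeidealI[OF M is_cring])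
  interpret M: ideal M R by fact
  \<comment> \<open>The zeroth power is one, so avoiding all powers makes M proper.\<close>
  have "z [^] (0::nat) \<notin> M"
    using disj by (auto simp only: range_composition)
  then show "carrier R \<noteq> M"
    by auto
  have power: "\<exists>(n::nat). \<exists>m\<in>M. \<exists>u\<in>carrier R. z [^] n = m \<oplus> u \<otimes> x" if x: "x \<in> carrier R" "x \<notin> M" for x
  proof -
    let ?J = "M <+>\<^bsub>R\<^esub> PIdl x"
    have J: "ideal ?J R"
      by (intro add_ideals M cgenideal_ideal x)
    have zero: "\<zero> \<in> PIdl x"
      by (intro additive_subgroup.zero_closed ideal.axioms(1) cgenideal_ideal x)
    have sum: "p \<oplus> q \<in> ?J" if "p \<in> M" "q \<in> PIdl x" for p q
      using that by (auto simp: set_add_def')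
    have "M \<subseteq> ?J"
    proof
      show "m \<in> ?J" if "m \<in> M" for m
        using sum[OF that zero] M.Icarr[OF that] by simp
    qed
    moreover have "x \<in> ?J"
      using sum[OF M.zero_closed cgenideal_self[OF x(1)]] x(1) by simp
    ultimately have "?J \<inter> range (\<lambda>n::nat. z [^] n) \<noteq> {}"
      using max[OF J] x(2) by blast
    then obtain n :: nat where "z [^] n \<in> ?J"
      by auto
    then obtain m q where "m \<in> M" "q \<in> PIdl x" "z [^] n = m \<oplus> q"
      by (auto simp: set_add_def')
    moreover obtain u where "u \<in> carrier R" "q = u \<otimes> x"
      using \<open>q \<in> PIdl x\<close> by (auto simp: cgenideal_def)
    ultimately show ?thesis
      by blast
  qed
  fix x y assume x: "x \<in> carrier R" and y: "y \<in> carrier R" and xy: "x \<otimes> y \<in> M"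
  show "x \<in> M \<or> y \<in> M"
  proof (rule ccontr)
    assume "\<not> (x \<in> M \<or> y \<in> M)"
    then obtain m n :: nat and p q u v where *: "p \<in> M" "q \<in> M" "u \<in> carrier R" "v \<in> carrier R"
      and eq: "z [^] m = p \<oplus> u \<otimes> x" "z [^] n = q \<oplus> v \<otimes> y"
      using power[OF x] power[OF y] by blast
    note pq = M.Icarr[OF *(1)] M.Icarr[OF *(2)]
    have "z [^] (m + n) = z [^] m \<otimes> z [^] n"
      using z by (simp add: nat_pow_mult)
    also have "\<dots> = (q \<oplus> v \<otimes> y) \<otimes> p \<oplus> ((u \<otimes> x) \<otimes> q \<oplus> (u \<otimes> v) \<otimes> (x \<otimes> y))"
      unfolding eq using x y *(3,4) pq by algebra
    also have "\<dots> \<in> M"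
      by (intro M.a_closed M.I_l_closed[OF *(1)] M.I_l_closed[OF *(2)] M.I_l_closed[OF xy])
        (use x y * pq in auto)
    finally show False
      using disj by blast
  qed
qed

text \<open>Bridge from the definition by prime ideals to the computations below. If no power of z
  is in I, an ideal containing I and maximal among those avoiding the powers is a prime that omits
  z. The exponent 0 is harmless: it gives one in I, so I is the whole ring, which is its own
  radical.\<close>

lemma radical_iff:
  assumes I: "ideal I R"
  shows "z \<in> radical R I \<longleftrightarrow> z \<in> carrier R \<and> (\<exists>n::nat. z [^] n \<in> I)"
proof (intro iffI conjI)
  assume z: "z \<in> radical R I"
  then show zc: "z \<in> carrier R"
    by (simp add: radical_def)
  show "\<exists>n::nat. z [^] n \<in> I"
  proof (rule ccontr)
    assume "\<not> ?thesis"
    then have disj: "I \<inter> range (\<lambda>n::nat. z [^] n) = {}"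
      by auto
    obtain M where M: "ideal M R" "I \<subseteq> M" "M \<inter> range (\<lambda>n::nat. z [^] n) = {}"
      "\<And>J. \<lbrakk>ideal J R; M \<subseteq> J; J \<inter> range (\<lambda>n::nat. z [^] n) = {}\<rbrakk> \<Longrightarrow> J = M"
      using ideal_maximal_disjoint[OF I disj] by blast
    have "primeideal M R"
      using primeideal_of_disjoint_powers[OF M(1) zc M(3,4)] .
    then have "z \<in> M"
      using z M(2) by (auto simp: radical_def)
    moreover have "z = z [^] (1::nat)"
      using zc by simp
    ultimately show False
      using M(3) by blast
  qed
next
  assume "z \<in> carrier R \<and> (\<exists>n::nat. z [^] n \<in> I)"
  then obtain n :: nat where z: "z \<in> carrier R" and n: "z [^] n \<in> I"
    by blast
  have "z \<in> P" if P: "primeideal P R" and "I \<subseteq> P" for P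
  proof -
    interpret P: primeideal P R by fact
    have "z [^] n \<in> P"
      using n \<open>I \<subseteq> P\<close> by blast
    then show ?thesis
    proof (induction n)
      case 0
      \<comment> \<open>One in P would contradict that P is proper.\<close>
      then show ?case
        using P.one_imp_carrier P.I_notcarr by simp
    next
      case (Suc n)
      then show ?case
        using P.I_prime[of "z [^] n" z] z by auto
    qed
  qed
  then show "z \<in> radical R I"
    using z by (auto simp: radical_def)
qed

lemma nilpotentI:
  assumes "z [^] (n::nat) = \<zero>" "z \<in> carrier R"
  shows "z \<in> radical R {\<zero>}"
  using assms by (auto simp: radical_iff zeroideal)

section \<open>Local rings\<close>

text \<open>Every nonunit lies in the unique maximal ideal. If both elements were nonunits, that
  ideal would contain (1 - yx) + yx = 1.\<close>

lemma Units_disj_of_local: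
  assumes loc: "local_ring R" and x: "x \<in> carrier R" "y \<in> carrier R"
  shows "x \<in> Units R \<or> \<one> \<ominus> y \<otimes> x \<in> Units R"
proof (rule ccontr)
  assume non: "\<not> ?thesis"
  have maximal: "\<exists>M. maximalideal M R \<and> u \<in> M" if u: "u \<in> carrier R" "u \<notin> Units R" for u
  proof -
    \<comment> \<open>A nonunit generates an ideal without one; an ideal maximal among those is a
      maximal ideal.\<close>
    have disj: "PIdl u \<inter> {\<one>} = {}"
      using u m_comm by (auto simp: cgenideal_def Units_def)
    obtain M where M: "ideal M R" "PIdl u \<subseteq> M" "M \<inter> {\<one>} = {}"
      "\<And>J. \<lbrakk>ideal J R; M \<subseteq> J; J \<inter> {\<one>} = {}\<rbrakk> \<Longrightarrow> J = M"
      using ideal_maximal_disjoint[OF cgenideal_ideal[OF u(1)] disj] by blast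
    have "maximalideal M R"
    proof (rule maximalidealI[OF M(1)])
      show "carrier R \<noteq> M"
        using M(3) by auto
      show "J = M \<or> J = carrier R" if "ideal J R" "M \<subseteq> J" for J
        using M(4)[OF that] ideal.one_imp_carrier[OF that(1)] by blast
    qed
    then show ?thesis
      using M(2) cgenideal_self[OF u(1)] by blast
  qed
  obtain M where M: "maximalideal M R" and uniq: "\<And>M'. maximalideal M' R \<Longrightarrow> M' = M"
    using loc by (auto simp: local_ring_def)
  interpret M: maximalideal M R by fact
  have "x \<in> M" "\<one> \<ominus> y \<otimes> x \<in> M"
    using maximal[of x] maximal[of "\<one> \<ominus> y \<otimes> x"] non x uniq by auto
  then have "(\<one> \<ominus> y \<otimes> x) \<oplus> y \<otimes> x \<in> M"
    using x by (intro M.a_closed M.I_l_closed)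
  moreover have "(\<one> \<ominus> y \<otimes> x) \<oplus> y \<otimes> x = \<one>"
    using x by algebra
  ultimately show False
    using M.one_imp_carrier M.I_notcarr by simp
qed

text \<open>The equation says (1 - yx)z = 0, and if x is not a unit then 1 - yx is one and can be
  cancelled. It is applied with z = x and with z = x^2.\<close>

lemma local_cancel:
  assumes loc: "local_ring R" and c: "x \<in> carrier R" "y \<in> carrier R" "z \<in> carrier R"
    and eq: "z = (y \<otimes> x) \<otimes> z"
  shows "x \<in> Units R \<or> z = \<zero>"
proof -
  have "z = \<zero>" if "\<one> \<ominus> y \<otimes> x \<in> Units R"
  proof -
    have "(\<one> \<ominus> y \<otimes> x) \<otimes> z = z \<ominus> (y \<otimes> x) \<otimes> z"
      using c by algebra
    also have "\<dots> = \<zero>"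
      using c by (simp flip: eq add: a_minus_def r_neg)
    also have "\<dots> = (\<one> \<ominus> y \<otimes> x) \<otimes> \<zero>"
      using c by simp
    finally show ?thesis
      using Units_l_cancel[OF that c(3) zero_closed] c by simp
  qed
  then show ?thesis
    using Units_disj_of_local[OF loc c(1,2)] by blast
qed

text \<open>A local von Neumann regular ring is a field: x = (yx)x, so a nonzero x is a unit by
  \<open>local_cancel\<close>.\<close>

lemma fieldI_of_idempotent_principal:
  assumes loc: "local_ring R"
    and sq: "\<And>x. x \<in> carrier R \<Longrightarrow> \<exists>y\<in>carrier R. x = y \<otimes> (x \<otimes> x)"
  shows "field R"
proof (rule cring_fieldI, rule equalityI)
  obtain M where "maximalideal M R"
    using loc by (auto simp: local_ring_def)
  then interpret M: maximalideal M R .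
  have "\<one> \<noteq> \<zero>"
    using M.I_notcarr M.one_imp_carrier M.zero_closed by auto
  then show "Units R \<subseteq> carrier R - {\<zero>}"
    by (auto simp: Units_def)
  show "carrier R - {\<zero>} \<subseteq> Units R"
  proof
    fix x assume "x \<in> carrier R - {\<zero>}"
    then have x: "x \<in> carrier R" "x \<noteq> \<zero>"
      by auto
    then obtain y where y: "y \<in> carrier R" "x = y \<otimes> (x \<otimes> x)"
      using sq by blast
    have "x = (y \<otimes> x) \<otimes> x"
      by (rule trans[OF y(2) m_assoc[OF y(1) x(1) x(1), symmetric]])
    then show "x \<in> Units R"
      using local_cancel[OF loc x(1) y(1) x(1)] x(2) by blast
  qed
qed

section \<open>Idempotents and their complements\<close>

lemma idempotent_nat_pow: "f \<in> carrier R \<Longrightarrow> f \<otimes> f = f \<Longrightarrow> f [^] Suc n = f"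
  by (induction n) auto

lemma complement_decomposition:
  assumes "x \<in> carrier R" "e \<in> carrier R"
  shows "x = x \<otimes> (\<one> \<ominus> e) \<oplus> x \<otimes> e"
  using assms by algebra

lemma complement_annihilates:
  assumes "x \<in> carrier R" "e \<in> carrier R" "x \<otimes> e = x"
  shows "x \<otimes> (\<one> \<ominus> e) = \<zero>"
proof -
  have "x \<otimes> (\<one> \<ominus> e) = x \<ominus> x \<otimes> e"
    using assms(1,2) by algebra
  then show ?thesis
    using assms by (simp add: a_minus_def r_neg)
qed

lemma idempotent_complement:
  assumes "e \<in> carrier R" "e \<otimes> e = e"
  shows "(\<one> \<ominus> e) \<otimes> (\<one> \<ominus> e) = \<one> \<ominus> e"
proof -
  have "(\<one> \<ominus> e) \<otimes> (\<one> \<ominus> e) = \<one> \<ominus> e \<ominus> e \<oplus> e \<otimes> e"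
    using assms(1) by algebra
  then show ?thesis
    unfolding assms(2) using assms(1) by algebra
qed

text \<open>The exponent is a successor because the zeroth power of the idempotent 1 - e is one, not
  1 - e.\<close>

lemma mult_complement_nat_pow:
  assumes x: "x \<in> carrier R" and e: "e \<in> carrier R" "e \<otimes> e = e"
  shows "(x \<otimes> (\<one> \<ominus> e)) [^] Suc n = x [^] Suc n \<otimes> (\<one> \<ominus> e)"
proof -
  have f: "\<one> \<ominus> e \<in> carrier R"
    using e(1) by simp
  show ?thesis
    unfolding nat_pow_distrib[OF x f] idempotent_nat_pow[OF f idempotent_complement[OF e]] ..
qed

text \<open>Let e kill N and I, and let z be in r(I). A positive power of z is in I, so the same
  power of ez is zero and ez is in N. Hence ez = e(ez) = 0. The other direction is antitonicity of
  the annihilator.\<close>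

lemma idempotent_in_annihilator_radical_iff:
  assumes I: "ideal I R" and e: "e \<in> carrier R" "e \<otimes> e = e"
  shows "e \<in> annihilator R (radical R I) \<longleftrightarrow>
    e \<in> annihilator R (radical R {\<zero>}) \<and> e \<in> annihilator R I"
proof
  assume "e \<in> annihilator R (radical R I)"
  then show "e \<in> annihilator R (radical R {\<zero>}) \<and> e \<in> annihilator R I"
    using annihilator_antimono[OF I ideal_radical[OF I] subset_radical[OF I]]
      annihilator_antimono[OF ideal_radical[OF zeroideal] ideal_radical[OF I] nilradical_subset_radical[OF I]]
    by blast
next
  assume "e \<in> annihilator R (radical R {\<zero>}) \<and> e \<in> annihilator R I"
  then have eN: "\<And>z. z \<in> radical R {\<zero>} \<Longrightarrow> e \<otimes> z = \<zero>"
    and eI: "\<And>z. z \<in> I \<Longrightarrow> e \<otimes> z = \<zero>"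
    by (auto simp: annihilator_iff ideal_radical zeroideal I)
  have "e \<otimes> z = \<zero>" if "z \<in> radical R I" for z
  proof -
    from that obtain n :: nat where z: "z \<in> carrier R" and n: "z [^] n \<in> I"
      by (auto simp: radical_iff I)
    \<comment> \<open>A positive exponent is needed for the powers of e to collapse to e.\<close>
    have "z [^] Suc n \<in> I"
      using ideal.I_r_closed[OF I n z] by simp
    then have "(e \<otimes> z) [^] Suc n = \<zero>"
      using e z eI by (simp only: nat_pow_distrib idempotent_nat_pow)
    then have "e \<otimes> z \<in> radical R {\<zero>}"
      by (rule nilpotentI) (use e z in auto)
    from eN[OF this] show ?thesis
      using e z by (simp flip: m_assoc)
  qed
  then show "e \<in> annihilator R (radical R I)"
    using e by (simp add: annihilator_iff ideal_radical I)
qed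

end

section \<open>Dual rings\<close>

locale dual_cring = cring +
  assumes annihilator_annihilator: "ideal I R \<Longrightarrow> annihilator R (annihilator R I) = I"

lemma dual_cringI: "dual_ring R \<Longrightarrow> dual_cring R"
  by (simp add: dual_ring_def dual_cring_def dual_cring_axioms_def ideals_def)

context dual_cring
begin

section \<open>Elements supplied by duality\<close>

text \<open>Duality for a principal ideal: x kills a((y)), hence lies in a(a((y))) = (y).\<close>

lemma multiple_of_annihilated:
  assumes c: "x \<in> carrier R" "y \<in> carrier R"
    and ann: "\<And>z. \<lbrakk>z \<in> carrier R; z \<otimes> y = \<zero>\<rbrakk> \<Longrightarrow> z \<otimes> x = \<zero>"
  shows "\<exists>w\<in>carrier R. x = w \<otimes> y"
proof -
  have Iy: "ideal (PIdl y) R"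
    by (rule cgenideal_ideal[OF c(2)])
  have "x \<otimes> z = \<zero>" if "z \<in> annihilator R (PIdl y)" for z
  proof -
    have z: "z \<in> carrier R" "z \<otimes> y = \<zero>"
      using that cgenideal_self[OF c(2)] unfolding annihilator_iff[OF Iy] by blast+
    show ?thesis
      using ann[OF z] m_comm[OF c(1) z(1)] by simp
  qed
  then have "x \<in> annihilator R (annihilator R (PIdl y))"
    using c by (simp add: annihilator_iff ideal_annihilator Iy)
  then show ?thesis
    unfolding annihilator_annihilator[OF Iy] by (auto simp: cgenideal_def)
qed

text \<open>If zx^3 = 0, then (zx)^3 = 0 and zx is in N, so x kills it: zx^2 = 0. Duality turns this
  inclusion of annihilators into a multiple.\<close>

lemma annihilator_nilradical_square:
  assumes x: "x \<in> annihilator R (radical R {\<zero>})"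
  shows "\<exists>y\<in>carrier R. x \<otimes> x = y \<otimes> (x \<otimes> x \<otimes> x)"
proof (rule multiple_of_annihilated)
  have xc: "x \<in> carrier R" and xN: "\<And>z. z \<in> radical R {\<zero>} \<Longrightarrow> x \<otimes> z = \<zero>"
    using x by (auto simp: annihilator_iff ideal_radical zeroideal)
  show "x \<otimes> x \<in> carrier R" "x \<otimes> x \<otimes> x \<in> carrier R"
    using xc by auto
  fix z assume z: "z \<in> carrier R" and eq: "z \<otimes> (x \<otimes> x \<otimes> x) = \<zero>"
  have "(z \<otimes> x) [^] (3::nat) = (z \<otimes> z) \<otimes> (z \<otimes> (x \<otimes> x \<otimes> x))"
    using z xc by (simp add: numeral_3_eq_3 m_ac)
  also have "\<dots> = \<zero>"
    using z by (simp add: eq)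
  finally have "z \<otimes> x \<in> radical R {\<zero>}"
    by (rule nilpotentI) (use z xc in auto)
  from xN[OF this] show "z \<otimes> (x \<otimes> x) = \<zero>"
    using z xc by (simp add: m_ac)
qed

lemma annihilator_nilradical_idempotent:
  assumes x: "x \<in> annihilator R (radical R {\<zero>})"
  obtains e w where "w \<in> carrier R" "e = w \<otimes> x" "e \<in> carrier R" "e \<otimes> e = e" "x \<otimes> x \<otimes> e = x \<otimes> x"
proof -
  have xc: "x \<in> carrier R"
    using x by (simp add: annihilator_iff ideal_radical zeroideal)
  obtain y where y: "y \<in> carrier R" and eq: "x \<otimes> x = y \<otimes> (x \<otimes> x \<otimes> x)"
    using annihilator_nilradical_square[OF x] by blast
  \<comment> \<open>From x^2 = (yx)x^2, the element yx acts as identity on x^2. It need not be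
    idempotent, but its square e is.\<close>
  define e where "e = y \<otimes> y \<otimes> x \<otimes> x"
  have xe: "x \<otimes> x \<otimes> e = x \<otimes> x"
  proof -
    have "x \<otimes> x \<otimes> e = (y \<otimes> x) \<otimes> (y \<otimes> (x \<otimes> x \<otimes> x))"
      unfolding e_def using xc y by (simp add: m_ac)
    also have "\<dots> = (y \<otimes> x) \<otimes> (x \<otimes> x)"
      by (simp only: eq[symmetric])
    also have "\<dots> = y \<otimes> (x \<otimes> x \<otimes> x)"
      using xc y by (simp add: m_ac)
    finally show ?thesis
      by (simp only: eq[symmetric])
  qed
  have "e \<otimes> e = y \<otimes> y \<otimes> (x \<otimes> x \<otimes> e)"
    unfolding e_def using xc y by (simp add: m_ac)
  also have "\<dots> = e"
    unfolding xe unfolding e_def using xc y by (simp add: m_ac)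
  finally have ee: "e \<otimes> e = e" .
  show thesis
  proof (rule that)
    show "y \<otimes> y \<otimes> x \<in> carrier R" "e = (y \<otimes> y \<otimes> x) \<otimes> x" "e \<in> carrier R"
      using xc y by (auto simp: e_def)
  qed (fact ee xe)+
qed

section \<open>Radicals and annihilators determined by idempotents\<close>

text \<open>For z^n in K, an idempotent e in (z^n) fixes z^(2n), so z^(2n)(1 - e) = 0 and z(1 - e)
  is nilpotent. Conversely, if z(1 - e) is nilpotent, some power of z is killed by 1 - e, hence
  equals its product with e and is in K.\<close>

lemma radical_idempotent_iff:
  assumes K: "ideal K R" and sub: "K \<subseteq> annihilator R (radical R {\<zero>})"
  shows "z \<in> radical R K \<longleftrightarrow>
    z \<in> carrier R \<and> (\<exists>e\<in>K. e \<otimes> e = e \<and> z \<otimes> (\<one> \<ominus> e) \<in> radical R {\<zero>})"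
proof
  assume "z \<in> radical R K"
  then obtain n :: nat where z: "z \<in> carrier R" and n: "z [^] n \<in> K"
    by (auto simp: radical_iff K)
  obtain e w where e: "w \<in> carrier R" "e = w \<otimes> z [^] n" "e \<in> carrier R" "e \<otimes> e = e"
    "z [^] n \<otimes> z [^] n \<otimes> e = z [^] n \<otimes> z [^] n"
    using annihilator_nilradical_idempotent[OF subsetD[OF sub n]] by blast
  have zero: "z [^] (n + n) \<otimes> (\<one> \<ominus> e) = \<zero>"
    unfolding nat_pow_mult[OF z, symmetric]
    by (intro complement_annihilates e m_closed nat_pow_closed z)
  have "(z \<otimes> (\<one> \<ominus> e)) [^] Suc (n + n) = z [^] Suc (n + n) \<otimes> (\<one> \<ominus> e)"
    by (rule mult_complement_nat_pow[OF z e(3,4)])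
  also have "\<dots> = z \<otimes> (z [^] (n + n) \<otimes> (\<one> \<ominus> e))"
    using z e(3) by (simp add: m_ac)
  also have "\<dots> = \<zero>"
    using z by (simp only: zero r_null)
  finally have "z \<otimes> (\<one> \<ominus> e) \<in> radical R {\<zero>}"
    by (rule nilpotentI) (use z e(3) in auto)
  moreover have "e \<in> K"
    using ideal.I_l_closed[OF K n e(1)] by (simp add: e(2))
  ultimately show "z \<in> carrier R \<and> (\<exists>e\<in>K. e \<otimes> e = e \<and> z \<otimes> (\<one> \<ominus> e) \<in> radical R {\<zero>})"
    using z e(4) by blast
next
  assume "z \<in> carrier R \<and> (\<exists>e\<in>K. e \<otimes> e = e \<and> z \<otimes> (\<one> \<ominus> e) \<in> radical R {\<zero>})"
  then obtain e where z: "z \<in> carrier R" and e: "e \<in> K" "e \<otimes> e = e"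
    and N: "z \<otimes> (\<one> \<ominus> e) \<in> radical R {\<zero>}"
    by blast
  note ec = ideal.Icarr[OF K e(1)]
  obtain n :: nat where "(z \<otimes> (\<one> \<ominus> e)) [^] n = \<zero>"
    using N by (auto simp: radical_iff zeroideal)
  \<comment> \<open>Passing to a successor exponent covers n = 0 in
    \<open>mult_complement_nat_pow\<close>.\<close>
  then have "(z \<otimes> (\<one> \<ominus> e)) [^] Suc n = \<zero>"
    using z ec by simp
  then have zero: "z [^] Suc n \<otimes> (\<one> \<ominus> e) = \<zero>"
    by (simp only: mult_complement_nat_pow[OF z ec e(2)])
  have "z [^] Suc n = z [^] Suc n \<otimes> (\<one> \<ominus> e) \<oplus> z [^] Suc n \<otimes> e"
    by (intro complement_decomposition nat_pow_closed z ec)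
  also have "\<dots> = z [^] Suc n \<otimes> e"
    unfolding zero using z ec by simp
  also have "\<dots> \<in> K"
    using ideal.I_l_closed[OF K e(1) nat_pow_closed[OF z]] .
  finally show "z \<in> radical R K"
    using z unfolding radical_iff[OF K] by blast
qed

lemma annihilator_radical_subset:
  assumes I: "ideal I R"
  shows "annihilator R (radical R I) \<subseteq> annihilator R (radical R {\<zero>})"
  by (intro annihilator_antimono ideal_radical zeroideal I nilradical_subset_radical)

lemma rar_iff:
  assumes I: "ideal I R"
  shows "z \<in> radical R (annihilator R (radical R I)) \<longleftrightarrow> z \<in> carrier R \<and>
    (\<exists>e\<in>annihilator R (radical R {\<zero>}) \<inter> annihilator R I.
      e \<otimes> e = e \<and> z \<otimes> (\<one> \<ominus> e) \<in> radical R {\<zero>})"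
proof -
  have "e \<in> annihilator R (radical R I) \<longleftrightarrow>
      e \<in> annihilator R (radical R {\<zero>}) \<inter> annihilator R I" if "e \<otimes> e = e" for e
    using idempotent_in_annihilator_radical_iff[OF I _ that]
    \<comment> \<open>Outside the carrier both memberships are false.\<close>
    by (cases "e \<in> carrier R") (auto simp: annihilator_def)
  then show ?thesis
    unfolding radical_idempotent_iff[OF ideal_annihilator[OF ideal_radical[OF I]]
        annihilator_radical_subset[OF I]]
    by blast
qed

text \<open>The idempotents of a(N) and a(I) lie in ar(I), hence in rar(I), so x must kill them.
  Conversely, each z in rar(I) splits as z(1 - e) + ze with such an e; x kills the first summand as
  an element of N and the second because xe = 0.\<close>

lemma annihilator_rar_iff:
  assumes I: "ideal I R"
  shows "x \<in> annihilator R (radical R (annihilator R (radical R I))) \<longleftrightarrow>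
    x \<in> annihilator R (radical R {\<zero>}) \<and>
    (\<forall>e\<in>annihilator R (radical R {\<zero>}) \<inter> annihilator R I. e \<otimes> e = e \<longrightarrow> x \<otimes> e = \<zero>)"
    (is "?L \<longleftrightarrow> ?R")
proof
  note ideals = ideal_annihilator ideal_radical zeroideal I
  assume L: ?L
  have "x \<in> annihilator R (radical R {\<zero>})"
    using annihilator_radical_subset[of "annihilator R (radical R I)"] L by (auto simp: ideals)
  moreover have "e \<in> radical R (annihilator R (radical R I))"
    if "e \<in> annihilator R (radical R {\<zero>}) \<inter> annihilator R I" "e \<otimes> e = e" for e
    using that idempotent_in_annihilator_radical_iff[OF I]
      subset_radical[of "annihilator R (radical R I)"]
    by (auto simp: annihilator_iff ideals)
  ultimately show ?R
    using L by (auto simp: annihilator_iff ideals)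
next
  note ideals = ideal_annihilator ideal_radical zeroideal I
  assume R: ?R
  then have x: "x \<in> carrier R" and xN: "\<And>z. z \<in> radical R {\<zero>} \<Longrightarrow> x \<otimes> z = \<zero>"
    by (auto simp: annihilator_iff ideals)
  have "x \<otimes> z = \<zero>" if "z \<in> radical R (annihilator R (radical R I))" for z
  proof -
    from that obtain e where z: "z \<in> carrier R" and e: "e \<in> annihilator R (radical R {\<zero>})"
      "e \<in> annihilator R I" "e \<otimes> e = e" "z \<otimes> (\<one> \<ominus> e) \<in> radical R {\<zero>}"
      unfolding rar_iff[OF I] by blast
    have ec: "e \<in> carrier R"
      using e(2) by (simp add: annihilator_iff I)
    have "x \<otimes> z = x \<otimes> (z \<otimes> (\<one> \<ominus> e)) \<oplus> z \<otimes> (x \<otimes> e)"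
      using x z ec by algebra
    also have "x \<otimes> (z \<otimes> (\<one> \<ominus> e)) = \<zero>"
      by (rule xN[OF e(4)])
    also have "x \<otimes> e = \<zero>"
      using R e(1-3) by blast
    finally show ?thesis
      using z by simp
  qed
  then show ?L
    using x by (simp add: annihilator_iff ideals)
qed

text \<open>For x in I, the product ex lies in both a(N) and I, so (ex) contains an idempotent f
  fixing (ex)^2. Orthogonality gives ef = 0, hence (ex)^2 = 0 and ex is in N. As e kills N, ex =
  e(ex) = 0.\<close>

lemma annihilator_iff_idempotents:
  assumes I: "ideal I R" and e: "e \<in> annihilator R (radical R {\<zero>})" "e \<otimes> e = e"
  shows "e \<in> annihilator R I \<longleftrightarrow>
    (\<forall>f\<in>annihilator R (radical R {\<zero>}) \<inter> I. f \<otimes> f = f \<longrightarrow> e \<otimes> f = \<zero>)"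
proof
  assume "e \<in> annihilator R I"
  then show "\<forall>f\<in>annihilator R (radical R {\<zero>}) \<inter> I. f \<otimes> f = f \<longrightarrow> e \<otimes> f = \<zero>"
    by (auto simp: annihilator_iff I)
next
  assume orth: "\<forall>f\<in>annihilator R (radical R {\<zero>}) \<inter> I. f \<otimes> f = f \<longrightarrow> e \<otimes> f = \<zero>"
  have N: "ideal (annihilator R (radical R {\<zero>})) R"
    by (intro ideal_annihilator ideal_radical zeroideal)
  have ec: "e \<in> carrier R"
    by (rule ideal.Icarr[OF N e(1)])
  have "e \<otimes> x = \<zero>" if xI: "x \<in> I" for x
  proof -
    have x: "x \<in> carrier R"
      by (rule ideal.Icarr[OF I xI])
    have ex: "e \<otimes> x \<in> annihilator R (radical R {\<zero>})" "e \<otimes> x \<in> I"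
      using ideal.I_r_closed[OF N e(1) x] ideal.I_l_closed[OF I xI ec] by auto
    obtain f w where f: "w \<in> carrier R" "f = w \<otimes> (e \<otimes> x)" "f \<in> carrier R" "f \<otimes> f = f"
      "(e \<otimes> x) \<otimes> (e \<otimes> x) \<otimes> f = (e \<otimes> x) \<otimes> (e \<otimes> x)"
      using annihilator_nilradical_idempotent[OF ex(1)] by blast
    have "f \<in> annihilator R (radical R {\<zero>})" "f \<in> I"
      unfolding f(2) using ideal.I_l_closed[OF N ex(1) f(1)] ideal.I_l_closed[OF I ex(2) f(1)] by auto
    then have ef: "e \<otimes> f = \<zero>"
      using orth f(4) by blast
    have "(e \<otimes> x) \<otimes> (e \<otimes> x) \<otimes> f = (e \<otimes> f) \<otimes> (e \<otimes> (x \<otimes> x))"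
      using ec x f(3) by (simp add: m_ac)
    then have "(e \<otimes> x) \<otimes> (e \<otimes> x) \<otimes> f = \<zero>"
      unfolding ef using ec x by simp
    then have "(e \<otimes> x) [^] (2::nat) = \<zero>"
      using f(5) ec x by (simp add: numeral_2_eq_2)
    then have "e \<otimes> x \<in> radical R {\<zero>}"
      by (rule nilpotentI) (use ec x in auto)
    then have "e \<otimes> (e \<otimes> x) = \<zero>"
      using e(1) by (simp add: annihilator_iff ideal_radical zeroideal)
    then show ?thesis
      using ec x e(2) by (simp flip: m_assoc)
  qed
  then show "e \<in> annihilator R I"
    using ec by (simp add: annihilator_iff I)
qed

lemma rar_eq_rarara:
  assumes I: "ideal I R"
  shows "radical R (annihilator R (radical R I)) =
    radical R (annihilator R (radical R (annihilator R (radical R (annihilator R I)))))"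
proof -
  note ideals = ideal_annihilator ideal_radical zeroideal I
  let ?K = "annihilator R (radical R (annihilator R (radical R (annihilator R I))))"
  have sub: "?K \<subseteq> annihilator R (radical R {\<zero>})"
    by (intro annihilator_radical_subset ideals)
  have "e \<in> ?K \<longleftrightarrow> e \<in> annihilator R (radical R {\<zero>}) \<inter> annihilator R I" if "e \<otimes> e = e" for e
    \<comment> \<open>Taken at a(I), the description of ara r involves a(a(I)) = I: the idempotents
      of \<open>?K\<close> are those of a(N) orthogonal to every idempotent of a(N) in I, which are
      exactly those killing I.\<close>
    unfolding annihilator_rar_iff[OF ideal_annihilator[OF I]] annihilator_annihilator[OF I]
    using annihilator_iff_idempotents[OF I _ that] by blast
  moreover have "ideal ?K R"
    by (intro ideals)
  ultimately show ?thesis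
    unfolding set_eq_iff rar_iff[OF I] using radical_idempotent_iff[OF _ sub] by blast
qed

section \<open>Local dual rings\<close>

text \<open>If zx^2 = 0, then (zx)^2 = 0, so zx = 0 in the absence of nilpotents. By duality x is a
  multiple of x^2.\<close>

lemma field_of_trivial_nilradical:
  assumes loc: "local_ring R" and N: "radical R {\<zero>} = {\<zero>}"
  shows "field R"
proof (rule fieldI_of_idempotent_principal[OF loc])
  fix x assume x: "x \<in> carrier R"
  show "\<exists>y\<in>carrier R. x = y \<otimes> (x \<otimes> x)"
  proof (rule multiple_of_annihilated)
    fix z assume z: "z \<in> carrier R" "z \<otimes> (x \<otimes> x) = \<zero>"
    have "(z \<otimes> x) [^] (2::nat) = z \<otimes> (z \<otimes> (x \<otimes> x))"
      using z(1) x by (simp add: numeral_2_eq_2 m_ac)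
    also have "\<dots> = \<zero>"
      using z by simp
    finally have "z \<otimes> x \<in> radical R {\<zero>}"
      by (rule nilpotentI) (use z x in auto)
    then show "z \<otimes> x = \<zero>"
      using N by blast
  qed (use x in auto)
qed

text \<open>A unit in a(N) would force N = 0 and make the ring a field. For a nonunit x, the
  equation x^2 = (yx)x^2 gives x^2 = 0 by \<open>local_cancel\<close>.\<close>

lemma local_annihilator_nilradical_subset:
  assumes loc: "local_ring R" and nf: "\<not> field R"
  shows "annihilator R (radical R {\<zero>}) \<subseteq> radical R {\<zero>}"
proof
  fix x assume x: "x \<in> annihilator R (radical R {\<zero>})"
  then have xc: "x \<in> carrier R" and xN: "\<And>z. z \<in> radical R {\<zero>} \<Longrightarrow> x \<otimes> z = \<zero>"
    by (auto simp: annihilator_iff ideal_radical zeroideal)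
  have "x \<notin> Units R"
  proof
    assume "x \<in> Units R"
    then have "z = \<zero>" if "z \<in> radical R {\<zero>}" for z
      using xN[OF that] Units_l_cancel[of x z \<zero>] that xc by (simp add: radical_def)
    then have "radical R {\<zero>} = {\<zero>}"
      using subset_radical[OF zeroideal] by auto
    then show False
      using field_of_trivial_nilradical[OF loc] nf by blast
  qed
  moreover obtain y where y: "y \<in> carrier R" "x \<otimes> x = y \<otimes> (x \<otimes> x \<otimes> x)"
    using annihilator_nilradical_square[OF x] by blast
  have "y \<otimes> (x \<otimes> x \<otimes> x) = (y \<otimes> x) \<otimes> (x \<otimes> x)"
    using xc y(1) by (simp add: m_assoc)
  then have "x \<otimes> x = (y \<otimes> x) \<otimes> (x \<otimes> x)"
    by (rule trans[OF y(2)])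
  ultimately have "x \<otimes> x = \<zero>"
    using local_cancel[OF loc xc y(1) m_closed[OF xc xc]] by blast
  then show "x \<in> radical R {\<zero>}"
    using xc by (intro nilpotentI[of x 2]) (auto simp: numeral_2_eq_2)
qed

text \<open>The idempotent e describing z in rar(I) is itself in N, so both summands of z = z(1 - e)
  + ze are in N.\<close>

lemma local_rar:
  assumes loc: "local_ring R" and nf: "\<not> field R" and I: "ideal I R"
  shows "radical R (annihilator R (radical R I)) = radical R {\<zero>}"
proof
  show "radical R {\<zero>} \<subseteq> radical R (annihilator R (radical R I))"
    by (intro nilradical_subset_radical ideal_annihilator ideal_radical I)
  interpret N: ideal "radical R {\<zero>}" R
    by (intro ideal_radical zeroideal)
  show "radical R (annihilator R (radical R I)) \<subseteq> radical R {\<zero>}"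
  proof
    fix z assume "z \<in> radical R (annihilator R (radical R I))"
    then obtain e where z: "z \<in> carrier R" and e: "e \<in> annihilator R (radical R {\<zero>})"
      "z \<otimes> (\<one> \<ominus> e) \<in> radical R {\<zero>}"
      unfolding rar_iff[OF I] by blast
    have eN: "e \<in> radical R {\<zero>}"
      using local_annihilator_nilradical_subset[OF loc nf] e(1) by blast
    have "z = z \<otimes> (\<one> \<ominus> e) \<oplus> z \<otimes> e"
      by (intro complement_decomposition z N.Icarr[OF eN])
    also have "\<dots> \<in> radical R {\<zero>}"
      by (intro N.a_closed N.I_l_closed[OF eN z] e(2))
    finally show "z \<in> radical R {\<zero>}" .
  qed
qed

end

section \<open>The radical-annihilator monoid\<close>

text \<open>The elements whose left multiplication maps \<open>W\<close> into itself form a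
  submonoid containing \<open>S\<close>, hence the hull. Applying them to \<open>\<one>\<close>
  lands in \<open>W\<close>, so only products with a generator on the left have to be
  checked.\<close>

lemma (in monoid) submonoid_hull_subset:
  assumes S: "S \<subseteq> carrier G" and W: "W \<subseteq> carrier G" "\<one> \<in> W"
    and closed: "\<And>s w. \<lbrakk>s \<in> S; w \<in> W\<rbrakk> \<Longrightarrow> s \<otimes> w \<in> W"
  shows "(\<lambda>N. submonoid N G) hull S \<subseteq> W"
proof -
  let ?T = "{x \<in> carrier G. \<forall>w\<in>W. x \<otimes> w \<in> W}"
  have "submonoid ?T G"
    by unfold_locales (use W in \<open>auto simp: m_assoc subset_iff\<close>)
  then have "(\<lambda>N. submonoid N G) hull S \<subseteq> ?T"
    using S closed by (intro hull_minimal) auto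
  also have "?T \<subseteq> W"
    using W(2) by force
  finally show ?thesis .
qed

context monoid
begin

lemma submonoid_hull_subset_words10:
  assumes c: "r \<in> carrier G" "a \<in> carrier G"
    and aa: "a \<otimes> a = \<one>" and rr: "r \<otimes> r = r"
    and rel: "r \<otimes> a \<otimes> r = r \<otimes> a \<otimes> r \<otimes> a \<otimes> r \<otimes> a"
  shows "(\<lambda>N. submonoid N G) hull {r, a} \<subseteq> set [\<one>, a, r, r \<otimes> a, a \<otimes> r, a \<otimes> (r \<otimes> a), r \<otimes> (a \<otimes> r),
    a \<otimes> (r \<otimes> (a \<otimes> r)), r \<otimes> (a \<otimes> (r \<otimes> a)), a \<otimes> (r \<otimes> (a \<otimes> (r \<otimes> a)))]"
proof (rule submonoid_hull_subset)
  have aa': "a \<otimes> (a \<otimes> x) = x" if "x \<in> carrier G" for x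
    using that c aa by (simp flip: m_assoc)
  have rr': "r \<otimes> (r \<otimes> x) = r \<otimes> x" if "x \<in> carrier G" for x
    using that c rr by (simp flip: m_assoc)
  have rel6: "r \<otimes> (a \<otimes> (r \<otimes> (a \<otimes> (r \<otimes> a)))) = r \<otimes> (a \<otimes> r)"
    using rel c by (simp add: m_assoc)
  \<comment> \<open>Multiplying rarara = rar by a on the right gives rarar = rara, so no alternating
    word starting with r needs more than four letters.\<close>
  have "r \<otimes> (a \<otimes> (r \<otimes> (a \<otimes> r))) = r \<otimes> (a \<otimes> (r \<otimes> (a \<otimes> (r \<otimes> a)))) \<otimes> a"
    using c aa by (simp add: m_assoc)
  also have "\<dots> = r \<otimes> (a \<otimes> (r \<otimes> a))"
    unfolding rel6 using c by (simp add: m_assoc)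
  finally have rel5: "r \<otimes> (a \<otimes> (r \<otimes> (a \<otimes> r))) = r \<otimes> (a \<otimes> (r \<otimes> a))" .
  show "s \<otimes> w \<in> set [\<one>, a, r, r \<otimes> a, a \<otimes> r, a \<otimes> (r \<otimes> a), r \<otimes> (a \<otimes> r),
      a \<otimes> (r \<otimes> (a \<otimes> r)), r \<otimes> (a \<otimes> (r \<otimes> a)), a \<otimes> (r \<otimes> (a \<otimes> (r \<otimes> a)))]"
    if "s \<in> {r, a}" and "w \<in> set [\<one>, a, r, r \<otimes> a, a \<otimes> r, a \<otimes> (r \<otimes> a), r \<otimes> (a \<otimes> r),
      a \<otimes> (r \<otimes> (a \<otimes> r)), r \<otimes> (a \<otimes> (r \<otimes> a)), a \<otimes> (r \<otimes> (a \<otimes> (r \<otimes> a)))]" for s w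
    using that c by (auto simp: aa rr aa' rr' rel5 rel6)
qed (use c in auto)

lemma submonoid_hull_subset_words8:
  assumes c: "r \<in> carrier G" "a \<in> carrier G"
    and aa: "a \<otimes> a = \<one>" and rr: "r \<otimes> r = r"
    and rel: "r \<otimes> a \<otimes> r = r \<otimes> a \<otimes> r \<otimes> a"
  shows "(\<lambda>N. submonoid N G) hull {r, a} \<subseteq> set [\<one>, a, r, r \<otimes> a, a \<otimes> r, a \<otimes> (r \<otimes> a), r \<otimes> (a \<otimes> r),
    a \<otimes> (r \<otimes> (a \<otimes> r))]"
proof (rule submonoid_hull_subset)
  have aa': "a \<otimes> (a \<otimes> x) = x" if "x \<in> carrier G" for x
    using that c aa by (simp flip: m_assoc)
  have rr': "r \<otimes> (r \<otimes> x) = r \<otimes> x" if "x \<in> carrier G" for x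
    using that c rr by (simp flip: m_assoc)
  have rel4: "r \<otimes> (a \<otimes> (r \<otimes> a)) = r \<otimes> (a \<otimes> r)"
    using rel c by (simp add: m_assoc)
  \<comment> \<open>Multiplying rara = rar by r on the right gives rarar = rar.\<close>
  have "r \<otimes> (a \<otimes> (r \<otimes> (a \<otimes> r))) = r \<otimes> (a \<otimes> (r \<otimes> a)) \<otimes> r"
    using c by (simp add: m_assoc)
  also have "\<dots> = r \<otimes> (a \<otimes> r)"
    unfolding rel4 using c rr by (simp add: m_assoc)
  finally have rel5: "r \<otimes> (a \<otimes> (r \<otimes> (a \<otimes> r))) = r \<otimes> (a \<otimes> r)" .
  show "s \<otimes> w \<in> set [\<one>, a, r, r \<otimes> a, a \<otimes> r, a \<otimes> (r \<otimes> a), r \<otimes> (a \<otimes> r), a \<otimes> (r \<otimes> (a \<otimes> r))]"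
    if "s \<in> {r, a}" and "w \<in> set [\<one>, a, r, r \<otimes> a, a \<otimes> r, a \<otimes> (r \<otimes> a), r \<otimes> (a \<otimes> r),
      a \<otimes> (r \<otimes> (a \<otimes> r))]" for s w
    using that c by (auto simp: aa rr aa' rr' rel4 rel5)
qed (use c in auto)

end

section \<open>From identities of ideals to relations between maps\<close>

lemma rad_ann_monoid_simps [simp]:
  "monoid.mult (rad_ann_monoid R) = monoid.mult (ideal_maps R)"
  "monoid.one (rad_ann_monoid R) = monoid.one (ideal_maps R)"
  "carrier (rad_ann_monoid R) = (\<lambda>N. submonoid N (ideal_maps R)) hull {rad_map R, ann_map R}"
  by (simp_all add: rad_ann_monoid_def)

text \<open>The words come as a list, whose length bounds the cardinality whether or not they denote
  distinct maps.\<close>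

lemma K_number_le:
  assumes "carrier (rad_ann_monoid R) \<subseteq> set xs" "length xs \<le> n"
  shows "K_number R \<le> enat n"
proof -
  have "card (carrier (rad_ann_monoid R)) \<le> n"
    using card_mono[OF finite_set assms(1)] card_length[of xs] assms(2) by linarith
  then show ?thesis
    using finite_subset[OF assms(1) finite_set] by (simp add: K_number_def)
qed

lemma ideal_maps_mult_apply:
  "I \<in> ideals R \<Longrightarrow> (f \<otimes>\<^bsub>ideal_maps R\<^esub> g) I = f (g I)"
  by (simp add: ideal_maps_def compose_def)

lemma ideal_maps_eqI:
  assumes "f \<in> carrier (ideal_maps R)" "g \<in> carrier (ideal_maps R)"
    and "\<And>I. I \<in> ideals R \<Longrightarrow> f I = g I"
  shows "f = g"
  by (rule PiE_ext[of _ "ideals R" "\<lambda>_. ideals R"]) (use assms in \<open>simp_all add: ideal_maps_def\<close>)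

context dual_cring
begin

lemma rad_map_apply: "I \<in> ideals R \<Longrightarrow> rad_map R I = radical R I"
  and ann_map_apply: "I \<in> ideals R \<Longrightarrow> ann_map R I = annihilator R I"
  by (simp_all add: rad_map_def ann_map_def)

lemma radical_in_ideals: "I \<in> ideals R \<Longrightarrow> radical R I \<in> ideals R"
  and annihilator_in_ideals: "I \<in> ideals R \<Longrightarrow> annihilator R I \<in> ideals R"
  by (simp_all add: ideals_def ideal_radical ideal_annihilator)

lemmas map_simps = ideal_maps_mult_apply rad_map_apply ann_map_apply
  radical_in_ideals annihilator_in_ideals

lemmas maps_closed = monoid.m_closed[OF monoid_ideal_maps] monoid.one_closed[OF monoid_ideal_maps]
  rad_map_closed[OF is_cring] ann_map_closed[OF is_cring]

lemma one_ideal_maps_apply: "I \<in> ideals R \<Longrightarrow> \<one>\<^bsub>ideal_maps R\<^esub> I = I"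
  by (simp add: ideal_maps_def)

lemma ann_map_involution: "ann_map R \<otimes>\<^bsub>ideal_maps R\<^esub> ann_map R = \<one>\<^bsub>ideal_maps R\<^esub>"
proof (rule ideal_maps_eqI)
  fix I assume "I \<in> ideals R"
  then show "(ann_map R \<otimes>\<^bsub>ideal_maps R\<^esub> ann_map R) I = \<one>\<^bsub>ideal_maps R\<^esub> I"
    \<comment> \<open>The compositions are evaluated with membership in \<open>ideals R\<close> kept
      folded, as the side conditions of \<open>map_simps\<close> require; it is unfolded only
      afterwards.\<close>
    using annihilator_annihilator[of I] by (simp add: map_simps one_ideal_maps_apply) (simp add: ideals_def)
qed (intro maps_closed)+

lemma rad_map_idempotent: "rad_map R \<otimes>\<^bsub>ideal_maps R\<^esub> rad_map R = rad_map R"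
proof (rule ideal_maps_eqI)
  fix I assume "I \<in> ideals R"
  then show "(rad_map R \<otimes>\<^bsub>ideal_maps R\<^esub> rad_map R) I = rad_map R I"
    using radical_radical[of I] by (simp add: map_simps) (simp add: ideals_def)
qed (intro maps_closed)+

lemma rar_map_eq_rarara_map:
  "rad_map R \<otimes>\<^bsub>ideal_maps R\<^esub> ann_map R \<otimes>\<^bsub>ideal_maps R\<^esub> rad_map R =
    rad_map R \<otimes>\<^bsub>ideal_maps R\<^esub> ann_map R \<otimes>\<^bsub>ideal_maps R\<^esub> rad_map R
      \<otimes>\<^bsub>ideal_maps R\<^esub> ann_map R \<otimes>\<^bsub>ideal_maps R\<^esub> rad_map R \<otimes>\<^bsub>ideal_maps R\<^esub> ann_map R"
proof (rule ideal_maps_eqI[where R = R])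
  fix I assume I: "I \<in> ideals R"
  then show "(rad_map R \<otimes>\<^bsub>ideal_maps R\<^esub> ann_map R \<otimes>\<^bsub>ideal_maps R\<^esub> rad_map R) I =
    (rad_map R \<otimes>\<^bsub>ideal_maps R\<^esub> ann_map R \<otimes>\<^bsub>ideal_maps R\<^esub> rad_map R
      \<otimes>\<^bsub>ideal_maps R\<^esub> ann_map R \<otimes>\<^bsub>ideal_maps R\<^esub> rad_map R \<otimes>\<^bsub>ideal_maps R\<^esub> ann_map R) I"
    using rar_eq_rarara[of I] by (simp add: map_simps) (simp add: ideals_def)
qed (intro maps_closed)+

lemma K_number_le_10: "K_number R \<le> 10"
proof -
  have "K_number R \<le> enat 10"
    by (rule K_number_le, unfold rad_ann_monoid_simps,
      rule monoid.submonoid_hull_subset_words10[OF monoid_ideal_maps rad_map_closed[OF is_cring]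
        ann_map_closed[OF is_cring] ann_map_involution rad_map_idempotent rar_map_eq_rarara_map])
      simp
  then show ?thesis
    by (simp add: numeral_eq_enat)
qed

lemma type_b_K_number:
  assumes "type_b R"
  shows "K_number R \<le> 8"
proof -
  have rel: "rad_map R \<otimes>\<^bsub>ideal_maps R\<^esub> ann_map R \<otimes>\<^bsub>ideal_maps R\<^esub> rad_map R =
    rad_map R \<otimes>\<^bsub>ideal_maps R\<^esub> ann_map R \<otimes>\<^bsub>ideal_maps R\<^esub> rad_map R \<otimes>\<^bsub>ideal_maps R\<^esub> ann_map R"
    using assms unfolding type_b_def Let_def rad_ann_monoid_simps by (rule conjunct2)
  have "K_number R \<le> enat 8"
    by (rule K_number_le, unfold rad_ann_monoid_simps,
      rule monoid.submonoid_hull_subset_words8[OF monoid_ideal_maps rad_map_closed[OF is_cring]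
        ann_map_closed[OF is_cring] ann_map_involution rad_map_idempotent rel])
      simp
  then show ?thesis
    by (simp add: numeral_eq_enat)
qed

text \<open>By \<open>local_rar\<close> the map rar is constant with value N, so composing it with a
  on the right changes nothing.\<close>

lemma local_type_b:
  assumes "local_ring R" "\<not> field R"
  shows "type_b R"
proof -
  have "rad_map R \<otimes>\<^bsub>ideal_maps R\<^esub> ann_map R \<otimes>\<^bsub>ideal_maps R\<^esub> rad_map R =
    rad_map R \<otimes>\<^bsub>ideal_maps R\<^esub> ann_map R \<otimes>\<^bsub>ideal_maps R\<^esub> rad_map R \<otimes>\<^bsub>ideal_maps R\<^esub> ann_map R"
  proof (rule ideal_maps_eqI[where R = R])
    fix I assume I: "I \<in> ideals R"
    then show "(rad_map R \<otimes>\<^bsub>ideal_maps R\<^esub> ann_map R \<otimes>\<^bsub>ideal_maps R\<^esub> rad_map R) I =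
      (rad_map R \<otimes>\<^bsub>ideal_maps R\<^esub> ann_map R \<otimes>\<^bsub>ideal_maps R\<^esub> rad_map R
        \<otimes>\<^bsub>ideal_maps R\<^esub> ann_map R) I"
      using local_rar[OF assms, of I] local_rar[OF assms ideal_annihilator, of I]
      by (simp add: map_simps) (simp add: ideals_def)
  qed (intro maps_closed)+
  then show ?thesis
    by (simp add: type_b_def ann_map_involution)
qed

lemma type_a_iff_rad_map: "type_a R \<longleftrightarrow> rad_map R = \<one>\<^bsub>ideal_maps R\<^esub>"
  by (simp add: type_a_def Let_def ann_map_involution)

text \<open>If r fixes the zero ideal, then N = 0 and the ring is a field. In a field the only
  ideals are zero, which is prime, and the whole ring; r fixes both.\<close>

lemma local_type_a_iff_field:
  assumes loc: "local_ring R"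
  shows "type_a R \<longleftrightarrow> field R"
proof
  assume "type_a R"
  then have "radical R {\<zero>} = {\<zero>}"
    using rad_map_apply[of "{\<zero>}"] one_ideal_maps_apply[of "{\<zero>}"]
    by (simp add: type_a_iff_rad_map ideals_def zeroideal)
  then show "field R"
    by (rule field_of_trivial_nilradical[OF loc])
next
  assume "field R"
  then interpret F: field R .
  have "radical R I = I" if "I \<in> ideals R" for I
  proof -
    have "I = {\<zero>} \<or> I = carrier R"
      using that F.all_ideals unfolding ideals_def by blast
    then show ?thesis
      using F.zeroprimeideal by (auto simp: radical_def)
  qed
  then show "type_a R"
    unfolding type_a_iff_rad_map
    by (intro ideal_maps_eqI[where R = R] maps_closed) (simp add: rad_map_apply one_ideal_maps_apply)
qed

text \<open>With r = 1 the monoid is generated by the involution a alone. The maps 1 and a differ at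
  the whole ring, whose annihilator omits the identity element.\<close>

lemma local_type_a_K_number:
  assumes loc: "local_ring R" and a: "type_a R"
  shows "K_number R = 2"
proof -
  let ?M = "ideal_maps R"
  interpret F: field R
    using local_type_a_iff_field[OF loc] a by blast
  have r: "rad_map R = \<one>\<^bsub>?M\<^esub>"
    using a by (simp add: type_a_iff_rad_map)
  have "(\<lambda>N. submonoid N ?M) hull {rad_map R, ann_map R} \<subseteq> {\<one>\<^bsub>?M\<^esub>, ann_map R}"
    by (rule monoid.submonoid_hull_subset[OF monoid_ideal_maps])
      (auto simp: r maps_closed ann_map_involution monoid.l_one[OF monoid_ideal_maps]
        monoid.r_one[OF monoid_ideal_maps])
  moreover have "{\<one>\<^bsub>?M\<^esub>, ann_map R} \<subseteq> (\<lambda>N. submonoid N ?M) hull {rad_map R, ann_map R}"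
    unfolding r by (rule hull_subset)
  ultimately have carrier: "carrier (rad_ann_monoid R) = {\<one>\<^bsub>?M\<^esub>, ann_map R}"
    by simp
  have "\<one> \<notin> annihilator R (carrier R)"
    using F.one_not_zero by (auto simp: annihilator_iff oneideal intro!: bexI[of _ \<one>])
  then have "ann_map R (carrier R) \<noteq> \<one>\<^bsub>?M\<^esub> (carrier R)"
    by (auto simp: ann_map_apply one_ideal_maps_apply ideals_def oneideal)
  then have "\<one>\<^bsub>?M\<^esub> \<noteq> ann_map R"
    by auto
  then show ?thesis
    unfolding K_number_def carrier by (simp add: numeral_eq_enat)
qed

end

theorem theorem4p7:
  fixes R :: "('a, 'b) ring_scheme"
  assumes "dual_ring R"
  shows "(local_ring R \<longrightarrow>
            (type_a R \<or> type_b R) \<and>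
            (type_a R \<longleftrightarrow> field R) \<and>
            (type_a R \<longrightarrow> K_number R = 2) \<and>
            (type_b R \<longrightarrow> K_number R \<le> 8)) \<and>
         (let M = rad_ann_monoid R; r = rad_map R; a = ann_map R in
            r \<otimes>\<^bsub>M\<^esub> a \<otimes>\<^bsub>M\<^esub> r
              = r \<otimes>\<^bsub>M\<^esub> a \<otimes>\<^bsub>M\<^esub> r \<otimes>\<^bsub>M\<^esub> a \<otimes>\<^bsub>M\<^esub> r \<otimes>\<^bsub>M\<^esub> a) \<and>
         K_number R \<le> 10"
proof -
  interpret dual_cring R
    by (rule dual_cringI[OF assms])
  show ?thesis
    unfolding Let_def rad_ann_monoid_simps
    using local_type_b local_type_a_iff_field local_type_a_K_number type_b_K_number
      rar_map_eq_rarara_map K_number_le_10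
    by blast
qed

end
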